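(* Let $K=\mathbb{F}_2(\theta)$ with absolute value $|a|=2^{\deg_\theta a}$, and let $C$ be the completion of an algebraic closure of $\mathbb{F}_2((1/\theta))$. Let $\vartheta\in C$, let $F=\bigcup_{n\geq0}\mathbb{F}_2(\vartheta^{1/2^n})\subset C$, and let $$f_\vartheta(x)=\prod_{n=0}^\infty\bigl(1-\vartheta x^{2^n}\bigr)=\sum_{n\ge 0}\vartheta^{b_n}x^n\in F[[x]],$$ where $b_n$ is the sum of the binary digits of $n$. Then $f_\vartheta$ is algebraic over $F(x)$ if and only if $\vartheta$ belongs to the algebraic closure $\overline{\mathbb{F}_2}$ of $\mathbb{F}_2$ in $C$.
   Context: In this part of the paper the author assumes $q=2$ throughout (the printed statement writes $\overline{\mathbb{F}_q}$ with $q=2$). *)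

theory Defs
  imports
    "HOL-Algebra.Algebraic_Closure_Type"
    "HOL-Algebra.Generated_Fields"
    "HOL-Analysis.Analysis"
    "HOL-Computational_Algebra.Computational_Algebra"
    "HOL-Library.Z2"
begin

section \<open>The field of Laurent series in the reciprocal of \<open>\<theta>\<close>\<close>

text \<open>
  The field \<open>\<bbbF>\<^sub>2((1/\<theta>))\<close> is the type \<open>bit fls\<close>, the formal variable \<open>fls_X\<close> being \<open>1/\<theta>\<close>.
  The absolute value is normalised so that on \<open>\<bbbF>\<^sub>2(\<theta>)\<close> it is 2 to the degree in \<open>\<theta>\<close>; this is
  \<open>laurent_abs_fraction\<close> below.
\<close>

definition theta :: "bit fls" where
  "theta = inverse fls_X"

definition laurent_abs :: "bit fls \<Rightarrow> real" where
  "laurent_abs a = (if a = 0 then 0 else 2 powi (- fls_subdegree a))"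

lemma laurent_abs_mult: "laurent_abs (a * b) = laurent_abs a * laurent_abs b"
  by (simp add: laurent_abs_def power_int_add power_int_diff power_int_minus divide_inverse)

lemma laurent_abs_inverse: "laurent_abs (inverse a) = inverse (laurent_abs a)"
  by (simp add: laurent_abs_def power_int_minus fls_inverse_subdegree)

lemma laurent_abs_poly:
  assumes "p \<noteq> 0"
  shows "laurent_abs (poly (map_poly fls_const p) theta) = 2 ^ Polynomial.degree p"
proof -
  have nth_sum: "fls_nth (sum g A) k = (\<Sum>i\<in>A. fls_nth (g i) k)"
    for g :: "nat \<Rightarrow> bit fls" and A k
    by (induction A rule: infinite_finite_induct) auto
  have nth: "fls_nth (poly (map_poly fls_const p) theta) k
      = (if k \<le> 0 then coeff p (nat (- k)) else 0)" for k
  proof -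
    have "poly (map_poly fls_const p) theta
        = (\<Sum>i\<le>Polynomial.degree p. fls_const (coeff p i) * fls_X_inv ^ i)"
      by (simp add: poly_altdef theta_def coeff_map_poly degree_map_poly fls_inverse_X)
    then have "fls_nth (poly (map_poly fls_const p) theta) k
        = (\<Sum>i\<le>Polynomial.degree p. coeff p i * (if k = - int i then 1 else 0))"
      by (simp add: nth_sum fls_X_inv_power_conv_shift_1 eq_neg_iff_add_eq_0)
    also have "\<dots> = (\<Sum>i\<le>Polynomial.degree p. if i = nat (- k) \<and> k \<le> 0 then coeff p i else 0)"
      by (intro sum.cong) auto
    also have "\<dots> = (if k \<le> 0 then coeff p (nat (- k)) else 0)"
      by (auto simp: sum.delta coeff_eq_0 not_le)
    finally show ?thesis .
  qed
  have "fls_subdegree (poly (map_poly fls_const p) theta) = - int (Polynomial.degree p)"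
    using assms by (intro fls_subdegree_eqI) (auto simp: nth coeff_eq_0)
  moreover have "poly (map_poly fls_const p) theta \<noteq> 0"
    using nth[of "- int (Polynomial.degree p)"] assms by auto
  ultimately show ?thesis
    by (simp add: laurent_abs_def)
qed

lemma laurent_abs_fraction:
  assumes "p \<noteq> 0" "q \<noteq> 0"
  shows "laurent_abs (poly (map_poly fls_const p) theta / poly (map_poly fls_const q) theta)
       = 2 powi (int (Polynomial.degree p) - int (Polynomial.degree q))"
  using assms
  by (simp add: divide_inverse laurent_abs_mult laurent_abs_inverse laurent_abs_poly power_int_diff)

section \<open>The completion of an algebraic closure\<close>

locale absolute_value =
  fixes nrm :: "'a :: field \<Rightarrow> real"
  assumes nrm_nonneg: "0 \<le> nrm x"
    and nrm_eq_0_iff: "nrm x = 0 \<longleftrightarrow> x = 0"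
    and nrm_mult: "nrm (x * y) = nrm x * nrm y"
    and nrm_triangle: "nrm (x + y) \<le> nrm x + nrm y"
begin

lemma nrm_minus_commute: "nrm (x - y) = nrm (y - x)"
proof -
  have "nrm (- 1) * nrm (- 1) = nrm 1 * nrm 1"
    by (simp flip: nrm_mult)
  then have "nrm (- 1) = nrm 1"
    by (metis abs_of_nonneg nrm_nonneg real_sqrt_abs2)
  then have "nrm (- 1 * (x - y)) = nrm (1 * (x - y))"
    by (simp only: nrm_mult)
  then show ?thesis by simp
qed

sublocale metric: Metric_space UNIV "\<lambda>x y. nrm (x - y)"
proof
  show "nrm (x - z) \<le> nrm (x - y) + nrm (y - z)" for x y z
    using nrm_triangle[of "x - y" "y - z"] by simp
qed (simp_all add: nrm_nonneg nrm_eq_0_iff nrm_minus_commute)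

end

text \<open>
  The type \<open>'c\<close> with absolute value \<open>nrm\<close> is a completion of the algebraic closure of
  \<open>\<bbbF>\<^sub>2((1/\<theta>))\<close>, via the map \<open>emb\<close>. The absolute value of the algebraic closure is the
  one induced by \<open>emb\<close>; no further condition on it is needed, since an absolute value on a
  complete field has only one extension to an algebraic closure.
\<close>

locale completed_alg_closure = absolute_value nrm for nrm :: "'c :: field \<Rightarrow> real" +
  fixes emb :: "bit fls alg_closure \<Rightarrow> 'c"
  assumes emb_1: "emb 1 = 1"
    and emb_add: "emb (x + y) = emb x + emb y"
    and emb_mult: "emb (x * y) = emb x * emb y"
    and nrm_emb: "nrm (emb (to_ac a)) = laurent_abs a"
    and dense: "metric.mtopology closure_of (range emb) = UNIV"
    and complete: "metric.mcomplete"

section \<open>Generated subfields and algebraic elements\<close>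

abbreviation subfield_generated :: "'a :: field set \<Rightarrow> 'a set" where
  "subfield_generated S \<equiv> generate_field (ring_of_type_algebra :: 'a ring) S"

definition algebraic_over :: "'a :: field set \<Rightarrow> 'a \<Rightarrow> bool" where
  "algebraic_over k a \<longleftrightarrow> (\<exists>p. p \<noteq> 0 \<and> (\<forall>i. coeff p i \<in> k) \<and> poly p a = 0)"

definition algebraic_closure_in :: "'a :: field set \<Rightarrow> 'a set" where
  "algebraic_closure_in k = {a. algebraic_over k a}"

text \<open>The field \<open>k(x)\<close> as a subfield of \<open>'a((x))\<close>.\<close>

definition rational_functions :: "'a :: field set \<Rightarrow> 'a fls set" where
  "rational_functions k = subfield_generated (fls_const ` k \<union> {fls_X})"

section \<open>The field \<open>F\<close> and the series\<close>

definition root_2_power :: "nat \<Rightarrow> 'c :: field \<Rightarrow> 'c" where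
  "root_2_power n a = (THE y. y ^ (2 ^ n) = a)"

context completed_alg_closure
begin

lemma char_2: "(1 :: 'c) + 1 = 0"
proof -
  have "emb 0 = 0"
    using emb_add[of 0 0] by (metis add_0 add_cancel_left_left)
  moreover have "(1 :: bit fls) + 1 = 0"
    by (metis fls_const_1 fls_plus_const fls_const_0 one_add_one bit_numeral_even)
  then have "(1 :: bit fls alg_closure) + 1 = 0"
    by (metis to_ac_0 to_ac_1 to_ac_add)
  ultimately show ?thesis
    by (metis emb_1 emb_add)
qed

lemma power2_diff_char_2: "(x - y)\<^sup>2 = x\<^sup>2 - y\<^sup>2" for x y :: 'c
proof -
  have two: "(2 :: 'c) = 0"
    using char_2 by (simp only: one_add_one)
  have "(x - y)\<^sup>2 - (x\<^sup>2 - y\<^sup>2) = 2 * (y\<^sup>2 - x * y)"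
    by (simp add: power2_eq_square algebra_simps)
  then show ?thesis
    by (simp add: two)
qed

lemma ex_square_root: "\<exists>y. y\<^sup>2 = (a :: 'c)"
proof -
  have "\<exists>b. nrm (a - emb b) < inverse (Suc k)" for k
  proof -
    have "a \<in> metric.mtopology closure_of (range emb)"
      by (simp add: dense)
    then show ?thesis
      unfolding metric.metric_closure_of
      by (force simp: metric.in_mball dest!: spec[of _ "inverse (Suc k)"])
  qed
  then obtain b where b: "\<And>k. nrm (a - emb (b k)) < inverse (Suc k)"
    by metis
  have "\<exists>c. c\<^sup>2 = b k" for k
    using nth_root_exists[of 2 "b k"] by auto
  then obtain c where c: "\<And>k. (c k)\<^sup>2 = b k"
    by metis
  have emb_c: "(emb (c k))\<^sup>2 = emb (b k)" for k
    by (metis c emb_mult power2_eq_square)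
  have nrm_square: "(nrm x)\<^sup>2 = nrm (x\<^sup>2)" for x
    by (simp add: power2_eq_square nrm_mult)
  have "metric.MCauchy (\<lambda>k. emb (c k))"
    unfolding metric.MCauchy_def
  proof (intro conjI allI impI)
    fix \<epsilon> :: real assume "\<epsilon> > 0"
    then obtain N where N: "inverse (Suc N) < \<epsilon>\<^sup>2 / 2"
      using reals_Archimedean[of "\<epsilon>\<^sup>2 / 2"] by auto
    have "nrm (emb (c m) - emb (c n)) < \<epsilon>" if "N \<le> m" "N \<le> n" for m n
    proof -
      have le: "inverse (real (Suc k)) \<le> inverse (Suc N)" if "N \<le> k" for k
        using that by (simp add: field_simps)
      have "(nrm (emb (c m) - emb (c n)))\<^sup>2 = nrm (emb (b m) - emb (b n))"
        by (simp add: nrm_square power2_diff_char_2 emb_c)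
      also have "\<dots> \<le> nrm (a - emb (b m)) + nrm (a - emb (b n))"
        using metric.triangle[of "emb (b m)" a "emb (b n)"] nrm_minus_commute[of a "emb (b m)"]
        by simp
      also have "\<dots> < \<epsilon>\<^sup>2"
        using b[of m] b[of n] le[OF that(1)] le[OF that(2)] N by linarith
      finally show ?thesis
        using \<open>\<epsilon> > 0\<close> by (meson power2_less_imp_less less_imp_le)
    qed
    then show "\<exists>N. \<forall>n n'. N \<le> n \<longrightarrow> N \<le> n' \<longrightarrow> nrm (emb (c n) - emb (c n')) < \<epsilon>"
      by blast
  qed simp
  then obtain y where y: "limitin metric.mtopology (\<lambda>k. emb (c k)) y sequentially"
    using complete unfolding metric.mcomplete_def by blast
  have "nrm (a - y\<^sup>2) \<le> \<epsilon>" if "\<epsilon> > 0" for \<epsilon>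
  proof -
    have "eventually (\<lambda>k. nrm (emb (c k) - y) < sqrt (\<epsilon> / 2)) sequentially"
      using y that unfolding metric.limitin_metric by auto
    moreover have "eventually (\<lambda>k. inverse (real (Suc k)) < \<epsilon> / 2) sequentially"
      using that by (intro order_tendstoD(2)[OF LIMSEQ_inverse_real_of_nat]) simp
    ultimately have "eventually (\<lambda>k. nrm (a - y\<^sup>2) \<le> \<epsilon>) sequentially"
    proof eventually_elim
      case (elim k)
      have "nrm (emb (b k) - y\<^sup>2) = (nrm (emb (c k) - y))\<^sup>2"
        by (simp add: nrm_square power2_diff_char_2 emb_c)
      also have "\<dots> \<le> (sqrt (\<epsilon> / 2))\<^sup>2"
        using elim(1) by (intro power_mono nrm_nonneg) auto
      also have "\<dots> = \<epsilon> / 2"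
        using that by simp
      finally show ?case
        using metric.triangle[of a "emb (b k)" "y\<^sup>2"] b[of k] elim(2) by simp
    qed
    then show ?thesis
      by simp
  qed
  then have "nrm (a - y\<^sup>2) = 0"
    by (metis field_le_epsilon add_0 antisym nrm_nonneg)
  then show ?thesis
    by (metis nrm_eq_0_iff right_minus_eq)
qed

lemma ex1_root_2_power: "\<exists>!y. y ^ (2 ^ n) = (a :: 'c)"
proof (induction n arbitrary: a)
  case (Suc n)
  have step: "y ^ (2 ^ Suc n) = (y ^ (2 ^ n))\<^sup>2" for y :: 'c
    by (simp add: mult.commute flip: power_mult)
  have "x = y" if "x\<^sup>2 = y\<^sup>2" for x y :: 'c
    using that power2_diff_char_2[of x y] by simp
  with ex_square_root[of a] obtain z where z: "\<And>x. x\<^sup>2 = a \<longleftrightarrow> x = z"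
    by metis
  show ?case
    unfolding step z by (rule Suc)
qed simp

lemma root_2_power: "root_2_power n a ^ (2 ^ n) = (a :: 'c)"
  unfolding root_2_power_def by (rule theI'[OF ex1_root_2_power])

end

text \<open>In characteristic 2, \<open>subfield_generated {a}\<close> is \<open>\<bbbF>\<^sub>2(a)\<close>.\<close>

definition perfect_hull :: "'c :: field \<Rightarrow> 'c set" where
  "perfect_hull a = (\<Union>n. subfield_generated {root_2_power n a})"

fun binary_digit_sum :: "nat \<Rightarrow> nat" where
  "binary_digit_sum n = (if n = 0 then 0 else n mod 2 + binary_digit_sum (n div 2))"

declare binary_digit_sum.simps [simp del]

text \<open>The infinite product is taken in the \<open>x\<close>-adic topology, which is the library's metric on \<open>fps\<close>.\<close>

definition f_series :: "'c :: field \<Rightarrow> 'c fps" where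
  "f_series a = prodinf (\<lambda>n. 1 - fps_const a * fps_X ^ (2 ^ n))"

end

theory Submission
  imports Defs
begin

text \<open>
  Write \<open>f\<^sub>a\<close> for the series with parameter \<open>a\<close>. In characteristic 2 squaring gives
  \<open>f\<^sub>b = (1 - b x) f\<^sub>a\<^sup>2\<close> for \<open>b = a\<^sup>2\<close>, so all the series with parameter \<open>a\<close> raised to a power of two
  lie in the vector space over \<open>k(x)\<close> spanned by the powers of \<open>f\<^sub>a\<close>. If \<open>a\<close> is algebraic over
  \<open>\<bbbF>\<^sub>2\<close>, two of these parameters coincide, which is an algebraic equation for \<open>f\<^sub>a\<close>. Otherwise they
  are infinitely many distinct elements outside \<open>{0, 1}\<close>; series with such parameters are
  linearly independent over \<open>k(x)\<close>, so the space is infinite dimensional and \<open>f\<^sub>a\<close> is not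
  algebraic. A polynomial relation between them splits, by
  \<open>f\<^sub>a(x) = (1 + a x) f\<^sub>a(x\<^sup>2)\<close>, into an even and an odd part of about half the degree; for
  coefficients of degree at most 1 the relation is a Vandermonde system.
\<close>

subsection \<open>Binary digit sums and the product formula\<close>

lemma binary_digit_sum_0 [simp]: "binary_digit_sum 0 = 0"
  by (simp add: binary_digit_sum.simps)

lemma binary_digit_sum_double [simp]: "binary_digit_sum (2 * n) = binary_digit_sum n"
  by (subst binary_digit_sum.simps) simp

lemma binary_digit_sum_Suc_double [simp]: "binary_digit_sum (Suc (2 * n)) = Suc (binary_digit_sum n)"
  by (subst binary_digit_sum.simps) simp

lemma binary_digit_sum_add_power2:
  "k < 2 ^ n \<Longrightarrow> binary_digit_sum (k + 2 ^ n) = Suc (binary_digit_sum k)"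
proof (induction n arbitrary: k)
  case 0
  then show ?case using binary_digit_sum_Suc_double[of 0] by simp
next
  case (Suc n)
  obtain m where "k = 2 * m \<or> k = Suc (2 * m)"
    by (metis evenE oddE Suc_eq_plus1)
  then show ?case
  proof
    assume k: "k = 2 * m"
    have "k + 2 ^ Suc n = 2 * (m + 2 ^ n)" using k by simp
    then show ?thesis using Suc.IH[of m] Suc.prems k
      by (metis binary_digit_sum_double nat_mult_less_cancel1 pos2 power_Suc)
  next
    assume k: "k = Suc (2 * m)"
    have "k + 2 ^ Suc n = Suc (2 * (m + 2 ^ n))" using k by simp
    then show ?thesis using Suc.IH[of m] Suc.prems k
      by (metis Suc_lessD binary_digit_sum_Suc_double nat_mult_less_cancel1 pos2 power_Suc)
  qed
qed

text \<open>The witness is 2^k - 1, reached by repeatedly appending a digit 1. Identities indexed by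
  digit sums thereby hold for every exponent, as the Vandermonde argument requires.\<close>

lemma ex_binary_digit_sum_eq: "\<exists>m. binary_digit_sum m = k"
  by (induction k) (auto intro: binary_digit_sum_0 binary_digit_sum_Suc_double)

text \<open>Over any field this is the expansion of the product of the factors 1 + a x^(2^n). The
  sign matches \<open>f_series\<close> in characteristic 2; the independence argument uses this form
  over an arbitrary field.\<close>

definition digit_series :: "'a :: field \<Rightarrow> 'a fps" where
  "digit_series a = Abs_fps (\<lambda>n. a ^ binary_digit_sum n)"

lemma digit_series_nth [simp]: "fps_nth (digit_series a) n = a ^ binary_digit_sum n"
  by (simp add: digit_series_def)

lemma digit_series_nonzero: "digit_series a \<noteq> 0"
proof
  assume "digit_series a = 0"
  then have "fps_nth (digit_series a) 0 = 0" by simp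
  then show False by (simp del: fps_zero_nth)
qed

text \<open>The coefficient of x is the parameter itself.\<close>

lemma inj_digit_series: "inj digit_series"
proof (rule injI)
  fix a b :: 'a assume "digit_series a = digit_series b"
  then have "fps_nth (digit_series a) (Suc (2 * 0)) = fps_nth (digit_series b) (Suc (2 * 0))"
    by simp
  then show "a = b"
    unfolding digit_series_nth binary_digit_sum_Suc_double by simp
qed

lemma uminus_char_2: "(2 :: 'a :: ring_1) = 0 \<Longrightarrow> - x = (x :: 'a)"
  by (metis add_eq_0_iff mult_2 mult_zero_left)

text \<open>The factor with index n copies the block of coefficients below 2^n to the next block,
  multiplied by - a = a. This extra power of a accounts for the new leading binary digit.\<close>

lemma partial_product_eq:
  fixes a :: "'a :: field"
  assumes "(2 :: 'a) = 0"
  shows "(\<Prod>i<n. 1 - fps_const a * fps_X ^ (2 ^ i))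
    = Abs_fps (\<lambda>k. if k < 2 ^ n then a ^ binary_digit_sum k else 0)"
proof (induction n)
  case 0
  show ?case by (rule fps_ext) simp
next
  case (Suc n)
  have "fps_nth (Abs_fps (\<lambda>k. if k < 2 ^ n then a ^ binary_digit_sum k else 0)
      * (1 - fps_const a * fps_X ^ (2 ^ n))) k
    = (if k < 2 ^ Suc n then a ^ binary_digit_sum k else 0)" for k
    using binary_digit_sum_add_power2[of "k - 2 ^ n" n] uminus_char_2[OF assms]
    by (auto simp: right_diff_distrib mult.left_commute fps_X_power_mult_right_nth)
  then show ?case
    by (intro fps_ext) (simp add: Suc)
qed

lemma has_prod_digit_series:
  fixes a :: "'a :: field"
  assumes "(2 :: 'a) = 0"
  shows "(\<lambda>n. 1 - fps_const a * fps_X ^ (2 ^ n)) has_prod digit_series a"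
proof -
  have "(\<lambda>n. \<Prod>i\<le>n. 1 - fps_const a * fps_X ^ (2 ^ i)) \<longlonglongrightarrow> digit_series a"
    unfolding lessThan_Suc_atMost [symmetric] partial_product_eq[OF assms] tendsto_fps_iff
  proof
    fix k
    have "k < 2 ^ Suc n" if "k \<le> n" for n
      using that by (meson le_less_trans less_exp lessI less_trans)
    then show "\<forall>\<^sub>F n in sequentially. fps_nth (Abs_fps (\<lambda>k. if k < 2 ^ Suc n then a ^ binary_digit_sum k else 0)) k
      = fps_nth (digit_series a) k"
      by (intro eventually_sequentiallyI[of k]) (simp del: power_Suc)
  qed
  \<comment> \<open>\<open>has_prod\<close> with all factors included demands a nonzero
    limit.\<close>
  then show ?thesis
    using digit_series_nonzero[of a] by (simp add: has_prod_def raw_has_prod_def)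
qed

text \<open>Squaring is additive in characteristic 2, so it sends factor n of the product for a to
  factor n + 1 of the product for a^2; only factor 0 of the latter, 1 - a^2 x, is left over. The
  computation is done on partial products long enough to determine the coefficient at k.\<close>

lemma digit_series_square:
  fixes a :: "'a :: field"
  assumes "(2 :: 'a) = 0"
  shows "digit_series (a\<^sup>2) = (1 - fps_const (a\<^sup>2) * fps_X) * (digit_series a)\<^sup>2"
proof (rule fps_ext)
  fix k
  let ?P = "\<lambda>a n. \<Prod>i<n. 1 - fps_const a * fps_X ^ (2 ^ i)"
  have nth: "fps_nth (?P b n) j = fps_nth (digit_series b) j" if "j \<le> k" "k \<le> n" for b :: 'a and n j
  proof -
    have "j < 2 ^ n" using that by (meson le_less_trans less_exp)
    then show ?thesis by (simp add: partial_product_eq[OF assms])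
  qed
  have two: "(2 :: 'a fps) = 0"
    by (metis assms fps_const_0_eq_0 numeral_fps_const)
  have square: "(1 - fps_const a * fps_X ^ N)\<^sup>2 = 1 - fps_const (a\<^sup>2) * fps_X ^ (2 * N)" for N
  proof -
    have "(1 - fps_const a * fps_X ^ N)\<^sup>2 = 1 + (fps_const a * fps_X ^ N)\<^sup>2"
      by (simp add: power2_diff two)
    also have "\<dots> = 1 - (fps_const a * fps_X ^ N)\<^sup>2"
      using uminus_char_2[OF two] by (metis diff_conv_add_uminus)
    finally show ?thesis
      by (simp add: power_mult_distrib fps_const_power mult.commute flip: power_mult)
  qed
  have "fps_nth (digit_series (a\<^sup>2)) k = fps_nth (?P (a\<^sup>2) (Suc k)) k"
    by (simp only: nth)
  also have "?P (a\<^sup>2) (Suc k) = (1 - fps_const (a\<^sup>2) * fps_X) * (?P a k)\<^sup>2"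
    by (simp add: prod.lessThan_Suc_shift prod_power_distrib square del: prod.lessThan_Suc)
  also have "fps_nth \<dots> k = fps_nth ((1 - fps_const (a\<^sup>2) * fps_X) * (digit_series a)\<^sup>2) k"
    unfolding power2_eq_square by (simp add: fps_mult_nth nth)
  finally show "fps_nth (digit_series (a\<^sup>2)) k = \<dots>" .
qed

subsection \<open>Linear independence\<close>

text \<open>The hypothesis extends linearly from monomials to all polynomials; testing it on one
  with root set \<open>A - {b}\<close> isolates \<open>c b\<close>.\<close>

lemma vandermonde_kernel:
  fixes c :: "'a :: field \<Rightarrow> 'a"
  assumes "finite A" "\<And>k. (\<Sum>a\<in>A. c a * a ^ k) = 0" "b \<in> A"
  shows "c b = 0"
proof -
  define q where "q = (\<Prod>a\<in>A - {b}. [:- a, 1:])"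
  have "(\<Sum>a\<in>A. c a * poly q a) = (\<Sum>k\<le>degree q. coeff q k * (\<Sum>a\<in>A. c a * a ^ k))"
    by (simp add: poly_altdef sum_distrib_left mult_ac sum.swap[of _ A])
  also have "\<dots> = 0" by (simp add: assms)
  finally have "(\<Sum>a\<in>A. c a * poly q a) = 0" .
  moreover have "poly q a = 0" if "a \<in> A - {b}" for a
    using that assms(1) by (auto simp: q_def poly_prod)
  ultimately have "c b * poly q b = 0"
    using assms(1,3) by (simp add: sum.remove)
  moreover have "poly q b \<noteq> 0"
    using assms(1) by (auto simp: q_def poly_prod)
  ultimately show ?thesis by simp
qed

text \<open>\<open>H\<close> is a series in x^2, so multiplication by it preserves the parity of
  exponents: the even or odd part of the product (r = 0 or 1) comes from the same part of
  \<open>q\<close>.\<close>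

lemma mult_even_series_nth:
  fixes q H :: "'a :: comm_ring_1 fps"
  assumes "\<And>n. odd n \<Longrightarrow> fps_nth H n = 0"
    and "r < 2"
  shows "fps_nth (q * H) (2 * n + r)
    = fps_nth (Abs_fps (\<lambda>k. fps_nth q (2 * k + r)) * Abs_fps (\<lambda>k. fps_nth H (2 * k))) n"
proof -
  let ?g = "\<lambda>k. 2 * k + r"
  have "fps_nth (q * H) (2 * n + r)
      = (\<Sum>i\<in>{0..2 * n + r}. fps_nth q i * fps_nth H (2 * n + r - i))"
    by (simp add: fps_mult_nth)
  also have "\<dots> = (\<Sum>i\<in>?g ` {0..n}. fps_nth q i * fps_nth H (2 * n + r - i))"
  proof (rule sum.mono_neutral_right)
    show "\<forall>i\<in>{0..2 * n + r} - ?g ` {0..n}. fps_nth q i * fps_nth H (2 * n + r - i) = 0"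
    proof
      fix i assume i: "i \<in> {0..2 * n + r} - ?g ` {0..n}"
      have "odd (2 * n + r - i)"
      proof
        assume "even (2 * n + r - i)"
        then obtain j where "2 * n + r - i = 2 * j" by (elim evenE)
        with i assms(2) have "i = ?g (n - j)" "n - j \<le> n" by auto
        with i show False by auto
      qed
      then show "fps_nth q i * fps_nth H (2 * n + r - i) = 0" by (simp add: assms)
    qed
  qed auto
  also have "\<dots> = (\<Sum>k\<in>{0..n}. fps_nth q (2 * k + r) * fps_nth H (2 * (n - k)))"
    by (subst sum.reindex) (auto simp: inj_on_def diff_mult_distrib2 intro!: sum.cong)
  finally show ?thesis by (simp add: fps_mult_nth)
qed

text \<open>Because f_a(x) = (1 + a x) f_a(x^2), the even and odd parts of a multiple of f_a are
  again governed by the same f_a. A linear relation thus splits into two relations between unchanged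
  series.\<close>

lemma mult_digit_series_nth:
  fixes p :: "'a :: field fps"
  assumes "r < 2"
  shows "fps_nth (p * digit_series a) (2 * n + r)
    = fps_nth (Abs_fps (\<lambda>k. fps_nth (p * (1 + fps_const a * fps_X)) (2 * k + r)) * digit_series a) n"
proof -
  \<comment> \<open>This is f_a(x^2), since doubling an index keeps its digit sum.\<close>
  define H where "H = Abs_fps (\<lambda>n. if even n then a ^ binary_digit_sum n else 0)"
  have "fps_nth (digit_series a) n = fps_nth ((1 + fps_const a * fps_X) * H) n" for n
  proof (cases "even n")
    case True
    then show ?thesis by (cases n) (auto simp: H_def distrib_right mult.assoc)
  next
    case False
    then obtain m where "n = Suc (2 * m)" by (metis oddE Suc_eq_plus1)
    then show ?thesis by (simp add: H_def distrib_right mult.assoc)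
  qed
  then have "digit_series a = (1 + fps_const a * fps_X) * H"
    by (rule fps_ext)
  then have "fps_nth (p * digit_series a) (2 * n + r) = fps_nth (p * (1 + fps_const a * fps_X) * H) (2 * n + r)"
    by (simp add: mult.assoc)
  also have "Abs_fps (\<lambda>k. fps_nth H (2 * k)) = digit_series a"
    by (rule fps_ext) (simp add: H_def)
  with mult_even_series_nth[of H r "p * (1 + fps_const a * fps_X)" n] assms
  have "fps_nth (p * (1 + fps_const a * fps_X) * H) (2 * n + r)
     = fps_nth (Abs_fps (\<lambda>k. fps_nth (p * (1 + fps_const a * fps_X)) (2 * k + r)) * digit_series a) n"
    by (simp add: H_def)
  finally show ?thesis .
qed

text \<open>Strong induction on the common degree bound \<open>D\<close>, by the parity splitting.
  The parameters 0 and 1 are excluded because f_0 = 1 and f_1 = 1/(1 - x) are dependent over the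
  rational functions.\<close>

lemma digit_series_independent:
  fixes p :: "'a :: field \<Rightarrow> 'a fps"
  assumes "finite A" "0 \<notin> A" "1 \<notin> A"
    and "\<And>a k. a \<in> A \<Longrightarrow> k > D \<Longrightarrow> fps_nth (p a) k = 0"
    and "(\<Sum>a\<in>A. p a * digit_series a) = 0"
    and "b \<in> A"
  shows "p b = 0"
  using assms(4,5)
proof (induction D arbitrary: p rule: less_induct)
  case (less D)
  note deg = less.prems(1)
  show ?case
  proof (cases "D \<le> 1")
    case True
    have deg1: "fps_nth (p a) k = 0" if "a \<in> A" "k > 1" for a k
      using that True by (intro deg) auto
    have rel: "(\<Sum>a\<in>A. fps_nth (p a) 0 * a ^ binary_digit_sum (Suc n)
        + fps_nth (p a) 1 * a ^ binary_digit_sum n) = 0" for n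
    proof -
      have eq: "fps_nth (p a * digit_series a) (Suc n)
          = fps_nth (p a) 0 * a ^ binary_digit_sum (Suc n) + fps_nth (p a) 1 * a ^ binary_digit_sum n"
        if "a \<in> A" for a
      proof -
        define u v where "u = fps_nth (p a) 0" and "v = fps_nth (p a) 1"
        have "p a = fps_const u + fps_const v * fps_X"
          using deg1[OF that] by (intro fps_ext) (auto simp: fps_X_def u_def v_def)
        then show ?thesis
          by (simp add: distrib_right mult.assoc flip: u_def v_def)
      qed
      have "fps_nth (\<Sum>a\<in>A. p a * digit_series a) (Suc n) = 0"
        using less.prems(2) by simp
      then show ?thesis by (simp add: fps_sum_nth eq)
    qed
    \<comment> \<open>Taking n = 2m, the indices n + 1 and n have digit sums k + 1 and k.\<close>
    have "(\<Sum>a\<in>A. (fps_nth (p a) 0 * a + fps_nth (p a) 1) * a ^ k) = 0" for k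
    proof -
      obtain m where m: "binary_digit_sum m = k" using ex_binary_digit_sum_eq by blast
      show ?thesis
        using rel[of "2 * m"] by (simp add: m distrib_right mult.assoc)
    qed
    from vandermonde_kernel[OF assms(1) this assms(6)]
    have 1: "fps_nth (p b) 0 * b + fps_nth (p b) 1 = 0" .
    \<comment> \<open>Taking n = 4m + 1, both indices have digit sum k + 1. With u, v the two
      coefficients of \<open>p b\<close>, the two systems give u b + v = 0 and (u + v) b = 0, so u =
      v = 0 as b is neither 0 nor 1.\<close>
    have "(\<Sum>a\<in>A. (fps_nth (p a) 0 + fps_nth (p a) 1) * a * a ^ k) = 0" for k
    proof -
      obtain m where m: "binary_digit_sum m = k" using ex_binary_digit_sum_eq by blast
      have "Suc (Suc (2 * (2 * m))) = 2 * Suc (2 * m)" by simp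
      then have digits: "binary_digit_sum (Suc (Suc (2 * (2 * m)))) = Suc k"
        "binary_digit_sum (Suc (2 * (2 * m))) = Suc k"
        by (simp_all only: binary_digit_sum_double binary_digit_sum_Suc_double m)
      show ?thesis
        using rel[of "Suc (2 * (2 * m))"] unfolding digits by (simp add: distrib_right mult.assoc)
    qed
    from vandermonde_kernel[OF assms(1) this assms(6)]
    have "fps_nth (p b) 0 + fps_nth (p b) 1 = 0" using assms(2,6) by auto
    with 1 have "(fps_nth (p b) 0 * b + fps_nth (p b) 1) - (fps_nth (p b) 0 + fps_nth (p b) 1) = 0"
      by simp
    then have "fps_nth (p b) 0 * (b - 1) = 0" by (simp add: algebra_simps)
    then have "fps_nth (p b) 0 = 0" using assms(3,6) by auto
    with 1 have "fps_nth (p b) k = 0" for k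
      using deg1[OF assms(6), of k] by (cases k rule: nat.exhaust; cases "k = 1") auto
    then show ?thesis by (intro fps_ext) simp
  next
    case False
    define q where "q = (\<lambda>a. p a * (1 + fps_const a * fps_X))"
    define s where "s = (\<lambda>r a. Abs_fps (\<lambda>k. fps_nth (q a) (2 * k + r)))"
    have q_nth: "fps_nth (q a) k = 0" if "a \<in> A" "k > Suc D" for a k
      using that deg[OF that(1)] by (simp add: q_def distrib_left mult.left_commute)
    have s0: "s r b = 0" if r: "r < 2" for r
    \<comment> \<open>Multiplication by 1 + a x raises the degree to at most D + 1, and each half
      then has degree at most (D + 1)/2. This is at most D - 1 exactly when D > 1, hence the base
      case D <= 1.\<close>
    proof (rule less.IH[of "D - 1"])
      show "D - 1 < D" using False by simp
      show "fps_nth (s r a) k = 0" if "a \<in> A" "k > D - 1" for a k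
        using that False by (simp add: s_def q_nth)
      show "(\<Sum>a\<in>A. s r a * digit_series a) = 0"
      proof (rule fps_ext)
        fix n
        have "fps_nth (\<Sum>a\<in>A. s r a * digit_series a) n
            = fps_nth (\<Sum>a\<in>A. p a * digit_series a) (2 * n + r)"
          unfolding fps_sum_nth s_def q_def by (simp add: mult_digit_series_nth[OF r])
        then show "fps_nth (\<Sum>a\<in>A. s r a * digit_series a) n = fps_nth 0 n"
          by (simp add: less.prems(2))
      qed
    qed
    have "fps_nth (q b) n = 0" for n
    proof -
      have "fps_nth (q b) n = fps_nth (s (n mod 2) b) (n div 2)"
        by (simp add: s_def)
      then show ?thesis by (simp add: s0)
    qed
    then have "q b = 0" by (intro fps_ext) simp
    moreover have "fps_nth (1 + fps_const b * fps_X) 0 = 1"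
      by simp
    then have "1 + fps_const b * fps_X \<noteq> 0"
      by (metis fps_zero_nth zero_neq_one)
    ultimately show ?thesis by (simp add: q_def)
  qed
qed

subsection \<open>Rational functions as Laurent series\<close>

abbreviation fls_of_poly :: "'a :: field poly \<Rightarrow> 'a fls" where
  "fls_of_poly p \<equiv> fps_to_fls (fps_of_poly p)"

text \<open>The embedding of K(x) into K((x)) for the full coefficient field K, described through
  representatives. Having K(x) as a field type makes the theory of vector spaces over it
  available.\<close>

definition fls_of_fract :: "'a :: field poly fract \<Rightarrow> 'a fls" where
  "fls_of_fract q = (THE f. \<exists>a b. b \<noteq> 0 \<and> q = Fract a b \<and> f = fls_of_poly a / fls_of_poly b)"

lemma fls_of_fract_Fract:
  assumes "b \<noteq> 0"
  shows "fls_of_fract (Fract a b) = fls_of_poly a / fls_of_poly b"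
  unfolding fls_of_fract_def
proof (rule the_equality)
  fix f assume "\<exists>c d. d \<noteq> 0 \<and> Fract a b = Fract c d \<and> f = fls_of_poly c / fls_of_poly d"
  then obtain c d where cd: "d \<noteq> 0" "a * d = c * b" "f = fls_of_poly c / fls_of_poly d"
    using assms by (auto simp: eq_fract)
  from cd(2) have "fls_of_poly a * fls_of_poly d = fls_of_poly c * fls_of_poly b"
    by (simp flip: fls_times_fps_to_fls fps_of_poly_mult)
  then show "f = fls_of_poly a / fls_of_poly b"
    using assms cd(1,3) by (simp add: frac_eq_eq)
qed (use assms in blast)

lemma fls_of_fract_add: "fls_of_fract (x + y) = fls_of_fract x + fls_of_fract y"
  by (cases x; cases y) (simp add: fls_of_fract_Fract add_frac_eq fps_of_poly_add fps_of_poly_mult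
      fls_times_fps_to_fls)

lemma fls_of_fract_mult: "fls_of_fract (x * y) = fls_of_fract x * fls_of_fract y"
  by (cases x; cases y) (simp add: fls_of_fract_Fract fps_of_poly_mult fls_times_fps_to_fls)

lemma fls_of_fract_uminus: "fls_of_fract (- x) = - fls_of_fract x"
  by (cases x) (simp add: fls_of_fract_Fract fps_of_poly_uminus)

lemma fls_of_fract_0: "fls_of_fract 0 = 0"
  by (simp add: Zero_fract_def fls_of_fract_Fract)

lemma fls_of_fract_1: "fls_of_fract 1 = 1"
  by (simp add: One_fract_def fls_of_fract_Fract)

lemma fls_of_fract_inverse: "fls_of_fract (inverse x) = inverse (fls_of_fract x)"
proof (cases "x = 0")
  case False
  then have "fls_of_fract x * fls_of_fract (inverse x) = 1"
    by (simp add: fls_of_fract_1 flip: fls_of_fract_mult)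
  then show ?thesis by (metis inverse_unique)
qed (simp add: fls_of_fract_0)

lemma vector_space_fls_of_fract: "vector_space (\<lambda>q f. fls_of_fract q * f)"
  by unfold_locales
    (simp_all add: fls_of_fract_add fls_of_fract_mult fls_of_fract_1 algebra_simps)

section \<open>Generated subfields in terms of the operations of the type\<close>

lemma ring_of_type_algebra_a_inv: "\<ominus>\<^bsub>ring_of_type_algebra\<^esub> x = - (x :: 'a :: field)"
proof -
  interpret R: Ring.field "ring_of_type_algebra :: 'a ring"
    by (rule field_from_type_algebra)
  show ?thesis
    by (rule R.minus_equality) (simp_all add: ring_of_type_algebra_def)
qed

lemma ring_of_type_algebra_m_inv:
  assumes "x \<noteq> 0"
  shows "inv\<^bsub>ring_of_type_algebra\<^esub> x = inverse (x :: 'a :: field)"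
proof -
  interpret R: Ring.field "ring_of_type_algebra :: 'a ring"
    by (rule field_from_type_algebra)
  show ?thesis
    using assms by (intro R.comm_inv_char) (simp_all add: ring_of_type_algebra_def)
qed

lemma subfield_generated_incl: "x \<in> S \<Longrightarrow> x \<in> subfield_generated S"
  by (rule generate_field.incl)

lemma subfield_generated_1: "1 \<in> subfield_generated S"
  using generate_field.one[of "ring_of_type_algebra :: 'a ring" S]
  by (simp add: ring_of_type_algebra_def)

lemma subfield_generated_uminus: "x \<in> subfield_generated S \<Longrightarrow> - x \<in> subfield_generated S"
  using generate_field.a_inv[of x "ring_of_type_algebra" S]
  by (simp add: ring_of_type_algebra_a_inv)

lemma subfield_generated_add:
  "x \<in> subfield_generated S \<Longrightarrow> y \<in> subfield_generated S \<Longrightarrow> x + y \<in> subfield_generated S"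
  using generate_field.eng_add[of x "ring_of_type_algebra" S y]
  by (simp add: ring_of_type_algebra_def)

lemma subfield_generated_mult:
  "x \<in> subfield_generated S \<Longrightarrow> y \<in> subfield_generated S \<Longrightarrow> x * y \<in> subfield_generated S"
  using generate_field.eng_mult[of x "ring_of_type_algebra" S y]
  by (simp add: ring_of_type_algebra_def)

lemma subfield_generated_0: "0 \<in> subfield_generated S"
  using subfield_generated_add[OF subfield_generated_1 subfield_generated_uminus[OF subfield_generated_1]]
  by simp

lemma subfield_generated_power: "x \<in> subfield_generated S \<Longrightarrow> x ^ n \<in> subfield_generated S"
  by (induction n) (auto intro: subfield_generated_1 subfield_generated_mult)

text \<open>The range is a subfield containing x and every constant. Passing from k(x) to this
  larger field is harmless for the negative direction: a series not algebraic over it is not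
  algebraic over k(x) either.\<close>

lemma rational_functions_subset_range: "rational_functions k \<subseteq> range fls_of_fract"
proof
  fix x :: "'a fls"
  assume "x \<in> rational_functions k"
  then show "x \<in> range fls_of_fract"
    unfolding rational_functions_def
  proof (induction rule: generate_field.induct)
    case one
    then show ?case
      by (metis fls_of_fract_1 rangeI ring.simps(1) monoid.simps(2) ring_of_type_algebra_def)
  next
    case (incl h)
    then consider c where "h = fls_const c" | "h = fls_X" by blast
    then show ?case
    proof cases
      case 1
      then have "h = fls_of_fract (Fract [:c:] 1)"
        by (simp add: fls_of_fract_Fract fps_of_poly_const)
      then show ?thesis by simp
    next
      case 2
      then have "h = fls_of_fract (Fract [:0, 1:] 1)"
        by (simp add: fls_of_fract_Fract fps_of_poly_pCons)
      then show ?thesis by simp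
    qed
  next
    case (a_inv h)
    then show ?case
      by (auto simp: ring_of_type_algebra_a_inv simp flip: fls_of_fract_uminus)
  next
    case (m_inv h)
    then have "h \<noteq> 0" by (simp add: ring_of_type_algebra_def)
    with m_inv show ?case
      by (auto simp: ring_of_type_algebra_m_inv simp flip: fls_of_fract_inverse)
  next
    case (eng_add x y)
    then show ?case
      by (auto simp: ring_of_type_algebra_def simp flip: fls_of_fract_add)
  next
    case (eng_mult x y)
    then show ?case
      by (auto simp: ring_of_type_algebra_def simp flip: fls_of_fract_mult)
  qed
qed

lemma digit_series_independent_fract:
  fixes w :: "'a :: field \<Rightarrow> 'a poly fract"
  assumes A: "finite A" "0 \<notin> A" "1 \<notin> A"
    and sum: "(\<Sum>a\<in>A. fls_of_fract (w a) * fps_to_fls (digit_series a)) = 0"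
    and b: "b \<in> A"
  shows "w b = 0"
proof -
  have "\<exists>n d. d \<noteq> 0 \<and> w a = Fract n d" for a
    by (cases "w a") auto
  then obtain n d where nd: "\<And>a. d a \<noteq> 0" "\<And>a. w a = Fract (n a) (d a)"
    by metis
  \<comment> \<open>The numerators after multiplication by the common denominator.\<close>
  define p where "p = (\<lambda>a. n a * (\<Prod>c\<in>A - {a}. d c))"
  have clear: "fls_of_poly (\<Prod>c\<in>A. d c) * fls_of_fract (w a) = fls_of_poly (p a)" if "a \<in> A" for a
  proof -
    have "(\<Prod>c\<in>A. d c) = d a * (\<Prod>c\<in>A - {a}. d c)"
      using A(1) that by (rule prod.remove)
    then show ?thesis
      using nd(1)[of a]
      by (simp add: nd(2) fls_of_fract_Fract[OF nd(1)] p_def fps_of_poly_mult fls_times_fps_to_fls)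
  qed
  have "fps_to_fls (\<Sum>a\<in>A. fps_of_poly (p a) * digit_series a)
      = (\<Sum>a\<in>A. fls_of_poly (p a) * fps_to_fls (digit_series a))"
    using A(1) by (induction rule: finite_induct) (simp_all add: fls_times_fps_to_fls)
  also have "\<dots> = fls_of_poly (\<Prod>c\<in>A. d c)
      * (\<Sum>a\<in>A. fls_of_fract (w a) * fps_to_fls (digit_series a))"
    by (simp add: sum_distrib_left clear flip: mult.assoc)
  finally have rel: "(\<Sum>a\<in>A. fps_of_poly (p a) * digit_series a) = 0"
    by (simp add: sum)
  have "fps_of_poly (p b) = 0"
  proof (rule digit_series_independent[OF A _ rel b])
    fix a k
    assume "a \<in> A" "(\<Sum>a\<in>A. degree (p a)) < k"
    moreover have "degree (p a) \<le> (\<Sum>a\<in>A. degree (p a))"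
      using A(1) \<open>a \<in> A\<close> by (intro member_le_sum) auto
    ultimately show "fps_nth (fps_of_poly (p a)) k = 0"
      by (simp add: coeff_eq_0)
  qed
  then have "n b = 0"
    using A(1) nd(1) by (simp add: p_def)
  then show ?thesis
    by (simp add: nd(2) fract_collapse)
qed

subsection \<open>Algebraicity\<close>

text \<open>The equation for f expresses f^d, with d its degree, through lower powers, so the span
  of these is stable under multiplication by f.\<close>

lemma algebraic_over_powers_in_span:
  fixes f :: "'a :: field fls"
  assumes "algebraic_over k f" "k \<subseteq> range fls_of_fract"
  obtains d where
    "\<And>n. f ^ n \<in> module.span (\<lambda>q f. fls_of_fract q * f) ((\<lambda>i. f ^ i) ` {..<d})"
proof -
  interpret V: vector_space "\<lambda>q f. fls_of_fract q * (f :: 'a fls)"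
    by (rule vector_space_fls_of_fract)
  obtain p where p: "p \<noteq> 0" "\<And>i. coeff p i \<in> k" "poly p f = 0"
    using assms(1) unfolding algebraic_over_def by blast
  define T where "T = (\<lambda>i. f ^ i) ` {..<degree p}"
  have "\<forall>i. \<exists>q. coeff p i = fls_of_fract q"
    using p(2) assms(2) by blast
  then obtain q where q: "\<And>i. coeff p i = fls_of_fract (q i)"
    by metis
  have top: "f ^ degree p \<in> V.span T"
  proof -
    have "fls_of_fract (q (degree p)) * f ^ degree p = - (\<Sum>i<degree p. fls_of_fract (q i) * f ^ i)"
      using p(3) by (simp add: poly_altdef q eq_neg_iff_add_eq_0 add.commute flip: lessThan_Suc_atMost)
    moreover have "fls_of_fract (q (degree p)) \<noteq> 0"
      using p(1) by (simp flip: q)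
    ultimately have "f ^ degree p
        = fls_of_fract (inverse (q (degree p))) * - (\<Sum>i<degree p. fls_of_fract (q i) * f ^ i)"
      unfolding fls_of_fract_inverse by (metis left_inverse mult.assoc mult_1)
    also have "\<dots> \<in> V.span T"
      by (intro V.span_scale V.span_neg V.span_sum) (auto simp: T_def intro: V.span_base)
    finally show ?thesis .
  qed
  have step: "f * v \<in> V.span T" if "v \<in> V.span T" for v
    using that
  proof (induction rule: V.span_induct_alt)
    case base
    then show ?case by (simp add: V.span_zero)
  next
    case (step c x y)
    then obtain i where i: "i < degree p" "x = f ^ i" by (auto simp: T_def)
    then have "f * x \<in> V.span T"
      using top by (cases "Suc i = degree p") (auto simp: T_def simp flip: power_Suc intro: V.span_base)
    then have "fls_of_fract c * (f * x) + f * y \<in> V.span T"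
      by (intro V.span_add V.span_scale step.IH)
    then show ?case by (simp add: algebra_simps)
  qed
  have "f ^ n \<in> V.span T" for n
  proof (induction n)
    case 0
    \<comment> \<open>If \<open>degree p = 0\<close>, the spanning set is empty and
      \<open>top\<close> is already the claim.\<close>
    then show ?case
      using top by (cases "degree p = 0") (auto simp: T_def intro!: V.span_base image_eqI[of _ _ 0])
  next
    case (Suc n)
    then show ?case by (simp add: step)
  qed
  then show ?thesis
    using that unfolding T_def by blast
qed

text \<open>Iterates \<open>digit_series_square\<close>, collecting the rational factors in
  \<open>R\<close>. The generating set is left open to serve both for constants from a given set k
  and for all constants.\<close>

lemma fps_to_fls_digit_series_power2:
  fixes a :: "'a :: field"
  assumes "(2 :: 'a) = 0" "fls_const a \<in> subfield_generated S" "fls_X \<in> subfield_generated S"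
  obtains R where "R \<in> subfield_generated S"
    "fps_to_fls (digit_series (a ^ (2 ^ m))) = R * fps_to_fls (digit_series a) ^ (2 ^ m)"
proof -
  have "\<exists>R\<in>subfield_generated S.
    fps_to_fls (digit_series (a ^ (2 ^ m))) = R * fps_to_fls (digit_series a) ^ (2 ^ m)"
  proof (induction m)
    case 0
    then show ?case using subfield_generated_1 by force
  next
    case (Suc m)
    then obtain R where R: "R \<in> subfield_generated S"
      "fps_to_fls (digit_series (a ^ (2 ^ m))) = R * fps_to_fls (digit_series a) ^ (2 ^ m)"
      by blast
    have exp: "x ^ 2 ^ Suc m = (x ^ 2 ^ m)\<^sup>2" for x :: "'b :: monoid_mult"
      by (simp add: power_mult [symmetric] mult.commute)
    let ?c = "1 - fls_const a ^ 2 ^ Suc m * fls_X"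
    have const_power: "fls_const (a ^ j) = fls_const a ^ j" for j
      by (induction j) (simp_all flip: fls_const_mult_const)
    have "fps_to_fls (digit_series (a ^ 2 ^ Suc m)) = ?c * (R * fps_to_fls (digit_series a) ^ 2 ^ m)\<^sup>2"
      unfolding exp[of a] digit_series_square[OF assms(1)]
      by (simp add: fls_times_fps_to_fls fps_to_fls_power R(2) flip: const_power exp)
    also have "\<dots> = (?c * R\<^sup>2) * fps_to_fls (digit_series a) ^ 2 ^ Suc m"
      unfolding exp[of "fps_to_fls (digit_series a)"] by (simp only: power_mult_distrib mult.assoc)
    finally have "fps_to_fls (digit_series (a ^ 2 ^ Suc m))
      = (?c * R\<^sup>2) * fps_to_fls (digit_series a) ^ 2 ^ Suc m" .
    moreover have "?c * R\<^sup>2 \<in> subfield_generated S"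
      unfolding diff_conv_add_uminus
      by (intro subfield_generated_mult subfield_generated_add subfield_generated_1
          subfield_generated_uminus subfield_generated_power assms R(1))
    ultimately show ?case by blast
  qed
  then show ?thesis using that by blast
qed

text \<open>If f_a were algebraic, its powers would span a finite-dimensional space containing
  infinitely many independent series.\<close>

lemma not_algebraic_over_digit_series:
  fixes a :: "'a :: field"
  assumes "(2 :: 'a) = 0" "inj (\<lambda>i. a ^ (2 ^ i :: nat))" "k \<subseteq> range fls_of_fract"
  shows "\<not> algebraic_over k (fps_to_fls (digit_series a))"
proof
  let ?h = "\<lambda>c. fps_to_fls (digit_series c)" and ?A = "range (\<lambda>i. a ^ (2 ^ i :: nat))"
  interpret V: vector_space "\<lambda>q f. fls_of_fract q * (f :: 'a fls)"
    by (rule vector_space_fls_of_fract)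
  assume "algebraic_over k (?h a)"
  then obtain d where d: "\<And>n. ?h a ^ n \<in> V.span ((\<lambda>i. ?h a ^ i) ` {..<d})"
    using assms(3) algebraic_over_powers_in_span by blast
  have "?h c \<in> V.span ((\<lambda>i. ?h a ^ i) ` {..<d})" if "c \<in> ?A" for c
  proof -
    from that obtain m where c: "c = a ^ 2 ^ m" by blast
    have gen: "fls_const a \<in> rational_functions UNIV" "fls_X \<in> rational_functions UNIV"
      by (auto simp: rational_functions_def intro!: subfield_generated_incl)
    obtain R where "R \<in> rational_functions UNIV" "?h c = R * ?h a ^ (2 ^ m)"
      using fps_to_fls_digit_series_power2[OF assms(1)] gen unfolding c rational_functions_def by metis
    moreover from this(1) obtain q where "R = fls_of_fract q"
      using rational_functions_subset_range by blast
    ultimately show ?thesis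
      using V.span_scale[OF d[of "2 ^ m"], of q] by simp
  qed
  then have sub: "?h ` ?A \<subseteq> V.span ((\<lambda>i. ?h a ^ i) ` {..<d})"
    by blast
  have inj: "inj_on ?h B" for B
    using inj_digit_series by (auto simp: inj_on_def)
  \<comment> \<open>Squaring moves one step along the sequence, so a fixed point would contradict
    injectivity; this rules out 0 and 1.\<close>
  have "c\<^sup>2 \<noteq> c" if "c \<in> ?A" for c
  proof -
    from that obtain i where i: "c = a ^ 2 ^ i" by blast
    have "c\<^sup>2 = a ^ 2 ^ Suc i"
      by (simp add: i mult.commute flip: power_mult)
    moreover have "a ^ 2 ^ Suc i \<noteq> a ^ 2 ^ i"
      using assms(2) by (metis injD n_not_Suc_n)
    ultimately show ?thesis using i by simp
  qed
  then have notin: "0 \<notin> ?A" "1 \<notin> ?A"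
    by (metis zero_power2, metis one_power2)
  have "V.independent (?h ` ?A)"
    unfolding V.independent_explicit_finite_subsets
  proof (intro allI impI ballI)
    fix S u v
    assume S: "S \<subseteq> ?h ` ?A" "finite S" "(\<Sum>v\<in>S. fls_of_fract (u v) * v) = 0" "v \<in> S"
    obtain B where B: "B \<subseteq> ?A" "S = ?h ` B"
      using S(1) by (auto simp: subset_image_iff)
    then have "finite B"
      using S(2) inj by (metis finite_imageD)
    moreover have "(\<Sum>c\<in>B. fls_of_fract (u (?h c)) * ?h c) = 0"
      using S(3) unfolding B(2) by (subst (asm) sum.reindex[OF inj]) simp
    moreover obtain c where c: "c \<in> B" "v = ?h c"
      using S(4) B(2) by blast
    ultimately show "u v = 0"
      using digit_series_independent_fract[of B "\<lambda>c. u (?h c)" c] notin B(1) by auto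
  qed
  then have "finite (?h ` ?A)"
    using V.independent_span_bound[OF _ _ sub] by blast
  then have "finite ?A"
    using inj by (rule finite_imageD)
  then show False
    using assms(2) finite_imageD infinite_UNIV_nat by blast
qed

text \<open>Two coinciding parameters give R f^(2^i) = R' f^(2^j) with R nonzero and different
  exponents, a nontrivial equation for f.\<close>

lemma algebraic_over_digit_series:
  fixes a :: "'a :: field"
  assumes "(2 :: 'a) = 0" "\<not> inj (\<lambda>i. a ^ (2 ^ i :: nat))" "a \<in> k"
  shows "algebraic_over (rational_functions k) (fps_to_fls (digit_series a))"
proof -
  let ?f = "fps_to_fls (digit_series a)"
  obtain i j where ij: "i \<noteq> j" "a ^ (2 ^ i) = a ^ (2 ^ j)"
    using assms(2) by (auto simp: inj_def)
  have gen: "fls_const a \<in> rational_functions k" "fls_X \<in> rational_functions k"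
    using assms(3) by (auto simp: rational_functions_def intro!: subfield_generated_incl)
  obtain R where R: "R \<in> rational_functions k" "fps_to_fls (digit_series (a ^ 2 ^ i)) = R * ?f ^ 2 ^ i"
    using fps_to_fls_digit_series_power2[OF assms(1)] gen unfolding rational_functions_def by metis
  obtain R' where R': "R' \<in> rational_functions k" "fps_to_fls (digit_series (a ^ 2 ^ j)) = R' * ?f ^ 2 ^ j"
    using fps_to_fls_digit_series_power2[OF assms(1)] gen unfolding rational_functions_def by metis
  define p where "p = monom R (2 ^ i) + monom (- R') (2 ^ j)"
  have "R \<noteq> 0"
    using R(2) digit_series_nonzero[of "a ^ 2 ^ i"] by auto
  then have "coeff p (2 ^ i) \<noteq> 0"
    using ij(1) by (simp add: p_def)
  then have "p \<noteq> 0" by auto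
  moreover have "coeff p n \<in> rational_functions k" for n
    using R(1) R'(1) unfolding p_def rational_functions_def
    unfolding coeff_add coeff_monom
    by (intro subfield_generated_add) (simp_all add: subfield_generated_0 subfield_generated_uminus)
  moreover have "poly p ?f = 0"
    using R(2) R'(2) ij(2) by (simp add: p_def poly_monom)
  ultimately show ?thesis
    unfolding algebraic_over_def by blast
qed

text \<open>If a is algebraic, its powers lie in a finite set, so the iterated squares repeat.
  Conversely, a repetition makes a a root of x^(2^i) + x^(2^j).\<close>

lemma algebraic_over_prime_field_iff:
  fixes a :: "'a :: field"
  assumes "(2 :: 'a) = 0"
  shows "algebraic_over {0, 1} a \<longleftrightarrow> \<not> inj (\<lambda>i. a ^ (2 ^ i :: nat))"
proof
  assume "\<not> inj (\<lambda>i. a ^ (2 ^ i :: nat))"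
  then obtain i j where ij: "i \<noteq> j" "a ^ (2 ^ i) = a ^ (2 ^ j)"
    by (auto simp: inj_def)
  \<comment> \<open>The sum equals the difference here and visibly has coefficients in
    \<open>{0, 1}\<close>.\<close>
  define p :: "'a poly" where "p = monom 1 (2 ^ i) + monom 1 (2 ^ j)"
  have coeff: "coeff p n = (if n = 2 ^ i \<or> n = 2 ^ j then 1 else 0)" for n
    using ij(1) by (auto simp: p_def)
  then have "coeff p (2 ^ i) \<noteq> 0" by simp
  then have "p \<noteq> 0" by auto
  moreover have "poly p a = 0"
    using ij(2) assms by (simp add: p_def poly_monom flip: mult_2)
  ultimately show "algebraic_over {0, 1} a"
    unfolding algebraic_over_def using coeff by (intro exI[of _ p]) simp
next
  assume "algebraic_over {0, 1} a"
  then obtain p where p: "p \<noteq> 0" "\<And>i. coeff p i \<in> {0, 1}" "poly p a = 0"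
    unfolding algebraic_over_def by blast
  define d where "d = degree p"
  \<comment> \<open>The span of 1, ..., a^(d-1) over the prime field; extensional coefficient
    functions make its finiteness immediate.\<close>
  define S where "S = (\<lambda>c. \<Sum>i<d. c i * a ^ i) ` ({..<d} \<rightarrow>\<^sub>E {0, 1})"
  have "finite S"
    by (simp add: S_def finite_PiE)
  have S_I: "(\<Sum>i<d. c i * a ^ i) \<in> S" if "\<And>i. c i \<in> {0, 1}" for c
    unfolding S_def using that
    by (intro image_eqI[of _ _ "restrict c {..<d}"]) (auto intro!: sum.cong)
  have S_0: "0 \<in> S"
    using S_I[of "\<lambda>_. 0"] by simp
  have S_add: "x + y \<in> S" if xy: "x \<in> S" "y \<in> S" for x y
  proof -
    obtain c c' where c: "c \<in> {..<d} \<rightarrow>\<^sub>E {0, 1}" "x = (\<Sum>i<d. c i * a ^ i)"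
      and c': "c' \<in> {..<d} \<rightarrow>\<^sub>E {0, 1}" "y = (\<Sum>i<d. c' i * a ^ i)"
      using xy unfolding S_def by blast
    have "x + y = (\<Sum>i<d. (if i < d then c i + c' i else 0) * a ^ i)"
      by (simp add: c c' distrib_right sum.distrib)
    also have "\<dots> \<in> S"
    proof (rule S_I)
      fix i
      show "(if i < d then c i + c' i else 0) \<in> {0, 1}"
      proof (cases "i < d")
        case True
        then have "c i \<in> {0, 1}" "c' i \<in> {0, 1}" using c(1) c'(1) by (auto simp: PiE_iff)
        then show ?thesis using assms by auto
      qed simp
    qed
    finally show ?thesis .
  qed
  have low: "a ^ j \<in> S" if "j < d" for j
  proof -
    have "(\<Sum>i<d. (if i = j then 1 else 0) * a ^ i) = (\<Sum>i<d. if i = j then a ^ i else 0)"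
      by (intro sum.cong) auto
    also have "\<dots> = a ^ j"
      using that by simp
    finally show ?thesis
      using S_I[of "\<lambda>i. if i = j then 1 else 0"] by simp
  qed
  have top: "a ^ d \<in> S"
  proof -
    have "coeff p d = 1"
      using p(1) p(2)[of d] by (auto simp: d_def)
    then have "a ^ d = - (\<Sum>i<d. coeff p i * a ^ i)"
      using p(3) by (simp add: poly_altdef eq_neg_iff_add_eq_0 add.commute flip: d_def lessThan_Suc_atMost)
    then show ?thesis
      using S_I[of "coeff p"] p(2) uminus_char_2[OF assms] by simp
  qed
  have step: "a * x \<in> S" if x: "x \<in> S" for x
  proof -
    obtain c where c: "c \<in> {..<d} \<rightarrow>\<^sub>E {0, 1}" "x = (\<Sum>i<d. c i * a ^ i)"
      using x unfolding S_def by blast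
    have "a * x = (\<Sum>i<d. c i * a ^ Suc i)"
      by (simp add: c(2) sum_distrib_left mult_ac)
    \<comment> \<open>Generalised to subsets so that closure of \<open>S\<close> under binary sums
      suffices by induction.\<close>
    also have "(\<Sum>i\<in>I. c i * a ^ Suc i) \<in> S" if "I \<subseteq> {..<d}" for I
      using finite_subset[OF that finite_lessThan] that
    proof (induction I rule: finite_induct)
      case empty
      then show ?case by (simp add: S_0)
    next
      case (insert i I)
      have "a ^ Suc i \<in> S"
        using insert.prems top low[of "Suc i"] by (cases "Suc i = d") auto
      moreover have "c i \<in> {0, 1}"
        using c(1) insert.prems by auto
      ultimately have "c i * a ^ Suc i \<in> S"
        by (auto simp: S_0)
      then show ?case
        using insert by (auto intro: S_add)
    qed
    from this[of "{..<d}"] have "(\<Sum>i<d. c i * a ^ Suc i) \<in> S" by simp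
    finally show ?thesis .
  qed
  have "a ^ n \<in> S" for n
  proof (induction n)
    case 0
    then show ?case using top low[of 0] by (cases "d = 0") auto
  next
    case (Suc n)
    then show ?case by (simp add: step)
  qed
  then have "finite (range (\<lambda>i. a ^ (2 ^ i :: nat)))"
    using \<open>finite S\<close> by (auto intro: finite_subset)
  then show "\<not> inj (\<lambda>i. a ^ (2 ^ i :: nat))"
    using finite_imageD infinite_UNIV_nat by blast
qed

section \<open>The coefficients in F and the conclusion\<close>

lemma power_in_perfect_hull: "a ^ n \<in> perfect_hull a"
proof -
  have "root_2_power 0 a = a"
    by (simp add: root_2_power_def)
  then have "a ^ n \<in> subfield_generated {root_2_power 0 a}"
    by (intro subfield_generated_power subfield_generated_incl) simp
  then show ?thesis
    unfolding perfect_hull_def by blast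
qed

text \<open>\<open>prodinf\<close> is a definite description, so convergence of the product is
  asserted together with the equivalence.\<close>

theorem theorem6:
  fixes nrm :: "'c :: field \<Rightarrow> real"
    and emb :: "bit fls alg_closure \<Rightarrow> 'c"
    and vartheta :: 'c
  assumes C: "completed_alg_closure nrm emb"
  shows "(\<lambda>n. 1 - fps_const vartheta * fps_X ^ (2 ^ n)) has_prod f_series vartheta
    \<and> f_series vartheta = Abs_fps (\<lambda>n. vartheta ^ binary_digit_sum n)
    \<and> (\<forall>n. fps_nth (f_series vartheta) n \<in> perfect_hull vartheta)
    \<and> (algebraic_over (rational_functions (perfect_hull vartheta)) (fps_to_fls (f_series vartheta))
        \<longleftrightarrow> vartheta \<in> algebraic_closure_in {0, 1})"
proof -
  interpret completed_alg_closure nrm emb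
    by (rule C)
  have two: "(2 :: 'c) = 0"
    using char_2 by (simp only: one_add_one)
  note prod = has_prod_digit_series[OF two, of vartheta]
  then have f: "f_series vartheta = digit_series vartheta"
    unfolding f_series_def by (rule has_prod_unique[symmetric])
  have "vartheta \<in> perfect_hull vartheta"
    using power_in_perfect_hull[of vartheta 1] by simp
  \<comment> \<open>Both sides of the equivalence are compared with a repetition among the iterated
    squares of \<open>vartheta\<close>.\<close>
  then have "algebraic_over (rational_functions (perfect_hull vartheta)) (fps_to_fls (digit_series vartheta))
      \<longleftrightarrow> \<not> inj (\<lambda>i. vartheta ^ (2 ^ i :: nat))"
    using algebraic_over_digit_series[OF two]
      not_algebraic_over_digit_series[OF two _ rational_functions_subset_range] by blast
  then show ?thesis
    using prod power_in_perfect_hull[of vartheta]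
    by (simp add: f algebraic_closure_in_def algebraic_over_prime_field_iff[OF two] flip: digit_series_def)
qed

end
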